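(* Let $k_1,k_2\ge 1$, let $A\in\mathbb{R}^{k_1\times k_2}$, and let $\eta_1,\eta_2>0$ be fixed step-sizes with $\sqrt{\eta_1\eta_2}\le\frac{2}{\|A\|}$. Let $(x_1^0,x_2^0)\in\mathbb{R}^{k_1}\times\mathbb{R}^{k_2}$ satisfy $\|x_1^0\|^2+\|x_2^0\|^2>0$, and let both agents use alternating gradient descent: $$x_1^{t+1}=x_1^t+\eta_1Ax_2^t,\qquad x_2^{t+1}=x_2^t-\eta_2A^\intercal x_1^{t+1},\qquad t\ge 0.$$ Then the strategies are bounded away from the equilibrium $(\mathbf{0},\mathbf{0})$, i.e. there is $c>0$ with $\|x_1^t\|^2+\|x_2^t\|^2\ge c$ for all $t\ge 0$. Formally, for all $t\ge 0$, $$\left(1+\frac{\sqrt{\eta_1\eta_2}\,\|A\|}{2}\right)\left(\frac{\|x_1^t\|^2}{\eta_1}+\frac{\|x_2^t\|^2}{\eta_2}\right)\ge\left(1-\frac{\sqrt{\eta_1\eta_2}\,\|A\|}{2}\right)\left(\frac{\|x_1^0\|^2}{\eta_1}+\frac{\|x_2^0\|^2}{\eta_2}\right).$$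
   Context: $\|\cdot\|$ is the Euclidean norm on vectors and the induced operator norm ($\ell_2$ matrix norm) on matrices. If $A=0$, $\frac{2}{\|A\|}$ is read as $+\infty$. *)

theory Defs
  imports "HOL-Analysis.Analysis"
begin

end

theory Submission
  imports Defs
begin

text \<open>
  The perturbed energy \<open>|u|\<^sup>2 / \<eta>1 + |v|\<^sup>2 / \<eta>2 + u \<bullet> A v\<close> is conserved by alternating
  gradient descent, and by AM-GM its cross term is at most
  \<open>sqrt (\<eta>1 \<eta>2) |A| / 2\<close> times the rest; this is the quantitative inequality. For small
  step-sizes the perturbed energy is positive semidefinite. If it is positive at the start,
  conservation bounds the iterates away from 0. In the boundary case
  \<open>sqrt (\<eta>1 \<eta>2) |A| = 2\<close> it may vanish at a nonzero point, but then completing the squares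
  shows that every step maps \<open>(u, v)\<close> to \<open>(- u, - v)\<close>, so the norms are constant.
\<close>

definition perturbed_energy ::
  "real \<Rightarrow> real \<Rightarrow> real ^ 'n ^ 'm \<Rightarrow> real ^ 'm \<Rightarrow> real ^ 'n \<Rightarrow> real" where
  "perturbed_energy \<eta>1 \<eta>2 A u v = (norm u)\<^sup>2 / \<eta>1 + (norm v)\<^sup>2 / \<eta>2 + u \<bullet> (A *v v)"

lemma norm_matrix_vector_le_onorm:
  fixes A :: "real ^ 'n ^ 'm"
  shows "norm (A *v v) \<le> onorm ((*v) A) * norm v"
  by (rule onorm) (rule matrix_vector_mul_bounded_linear)

lemma onorm_matrix_nonneg:
  fixes A :: "real ^ 'n ^ 'm"
  shows "0 \<le> onorm ((*v) A)"
  by (rule onorm_pos_le) (rule matrix_vector_mul_bounded_linear)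

text \<open>Testing \<open>A\<close> on \<open>w = transpose A *v u\<close> gives
  \<open>|w|^2 = u \<bullet> A w\<close>, and one factor \<open>|w|\<close> cancels after
  Cauchy-Schwarz.\<close>

lemma norm_transpose_le_onorm:
  fixes A :: "real ^ 'n ^ 'm"
  shows "norm (transpose A *v u) \<le> onorm ((*v) A) * norm u"
proof (cases "transpose A *v u = 0")
  case True
  then show ?thesis using onorm_matrix_nonneg[of A] by simp
next
  case False
  define w where "w = transpose A *v u"
  have "norm w * norm w = u \<bullet> (A *v w)"
    by (simp add: w_def dot_lmul_matrix[symmetric] flip: power2_eq_square power2_norm_eq_inner)
  also have "\<dots> \<le> norm u * norm (A *v w)"
    by (rule norm_cauchy_schwarz)
  also have "\<dots> \<le> norm u * (onorm ((*v) A) * norm w)"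
    by (intro mult_left_mono norm_matrix_vector_le_onorm) simp
  finally have "norm w * norm w \<le> (onorm ((*v) A) * norm u) * norm w"
    by (simp add: mult_ac)
  then show ?thesis using False by (simp add: w_def)
qed

text \<open>Both updates are differences of squares: the first changes
  \<open>|u|^2 / \<eta>1\<close> by \<open>(u + u') \<bullet> A v\<close>, the second changes
  \<open>|v|^2 / \<eta>2\<close> by \<open>- u' \<bullet> A (v + v')\<close>. The terms
  \<open>u' \<bullet> A v\<close> cancel, and the other two turn the old cross term into the new
  one.\<close>

lemma perturbed_energy_step:
  fixes A :: "real ^ 'n ^ 'm"
  assumes "\<eta>1 > 0" "\<eta>2 > 0"
    and u': "u' = u + \<eta>1 *\<^sub>R (A *v v)"
    and v': "v' = v - \<eta>2 *\<^sub>R (transpose A *v u')"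
  shows "perturbed_energy \<eta>1 \<eta>2 A u' v' = perturbed_energy \<eta>1 \<eta>2 A u v"
proof -
  have "(norm u')\<^sup>2 / \<eta>1 = (norm u)\<^sup>2 / \<eta>1 + u \<bullet> (A *v v) + u' \<bullet> (A *v v)"
    using assms(1) unfolding u' power2_norm_eq_inner
    by (simp add: inner_add_left inner_add_right inner_commute field_simps)
  moreover have "v = v' + \<eta>2 *\<^sub>R (transpose A *v u')"
    using v' by simp
  then have "(norm v)\<^sup>2 / \<eta>2 = (norm v')\<^sup>2 / \<eta>2 + v' \<bullet> (transpose A *v u') + v \<bullet> (transpose A *v u')"
    using assms(2) unfolding power2_norm_eq_inner
    by (simp add: inner_add_left inner_add_right inner_commute field_simps)
  moreover have "w \<bullet> (transpose A *v u') = u' \<bullet> (A *v w)" for w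
    by (simp add: inner_commute dot_lmul_matrix[symmetric])
  ultimately show ?thesis
    unfolding perturbed_energy_def by simp
qed

lemma abs_cross_term_le:
  fixes A :: "real ^ 'n ^ 'm"
  assumes "\<eta>1 > 0" "\<eta>2 > 0"
  shows "\<bar>u \<bullet> (A *v v)\<bar> \<le>
    sqrt (\<eta>1 * \<eta>2) * onorm ((*v) A) / 2 * ((norm u)\<^sup>2 / \<eta>1 + (norm v)\<^sup>2 / \<eta>2)"
proof -
  \<comment> \<open>Rescaled so that the weighted energy is \<open>a^2 + b^2\<close>; the factor
    \<open>sqrt (\<eta>1 * \<eta>2)\<close> is the price of the rescaling in the product of the
    norms.\<close>
  define a b where "a = norm u / sqrt \<eta>1" and "b = norm v / sqrt \<eta>2"
  have ab: "norm u = sqrt \<eta>1 * a" "norm v = sqrt \<eta>2 * b"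
    using assms by (simp_all add: a_def b_def)
  have sq: "(norm u)\<^sup>2 / \<eta>1 = a\<^sup>2" "(norm v)\<^sup>2 / \<eta>2 = b\<^sup>2"
    using assms by (simp_all add: a_def b_def power_divide)
  have "\<bar>u \<bullet> (A *v v)\<bar> \<le> norm u * norm (A *v v)"
    by (rule Cauchy_Schwarz_ineq2)
  also have "\<dots> \<le> norm u * (onorm ((*v) A) * norm v)"
    by (intro mult_left_mono norm_matrix_vector_le_onorm) simp
  also have "\<dots> = sqrt (\<eta>1 * \<eta>2) * onorm ((*v) A) * (a * b)"
    by (simp add: ab real_sqrt_mult)
  also have "\<dots> \<le> sqrt (\<eta>1 * \<eta>2) * onorm ((*v) A) * ((a\<^sup>2 + b\<^sup>2) / 2)"
    using assms sum_squares_bound[of a b] onorm_matrix_nonneg[of A]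
    by (intro mult_left_mono) auto
  finally show ?thesis
    unfolding sq by simp
qed

text \<open>Completing the square in \<open>u\<close>, respectively in \<open>v\<close>, leaves a
  remainder in the other variable alone. Each form supplies one of the two equations that hold at a
  zero of the energy.\<close>

lemma perturbed_energy_eq_squares:
  fixes A :: "real ^ 'n ^ 'm"
  assumes "\<eta>1 > 0" "\<eta>2 > 0"
  shows "perturbed_energy \<eta>1 \<eta>2 A u v =
      (norm (u + (\<eta>1 / 2) *\<^sub>R (A *v v)))\<^sup>2 / \<eta>1
      + ((norm v)\<^sup>2 / \<eta>2 - \<eta>1 * (norm (A *v v))\<^sup>2 / 4)" (is ?fst)
    and "perturbed_energy \<eta>1 \<eta>2 A u v =
      (norm (v + (\<eta>2 / 2) *\<^sub>R (transpose A *v u)))\<^sup>2 / \<eta>2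
      + ((norm u)\<^sup>2 / \<eta>1 - \<eta>2 * (norm (transpose A *v u))\<^sup>2 / 4)" (is ?snd)
proof -
  show ?fst
    using assms unfolding perturbed_energy_def power2_norm_eq_inner
    by (simp add: inner_add_left inner_add_right inner_commute field_simps)
  have "u \<bullet> (A *v v) = v \<bullet> (transpose A *v u)"
    by (simp add: inner_commute dot_lmul_matrix[symmetric])
  then show ?snd
    using assms unfolding perturbed_energy_def power2_norm_eq_inner
    by (simp add: inner_add_left inner_add_right inner_commute field_simps)
qed

text \<open>Handles both remainders of the completed squares: \<open>z\<close> is the norm of a
  vector, \<open>y\<close> that of its image under \<open>A\<close> or its transpose,
  \<open>L\<close> the norm of \<open>A\<close>.\<close>

lemma square_defect_nonneg:
  fixes L y z :: real
  assumes "\<eta> > 0" "\<eta>' > 0" "0 \<le> y" "y \<le> L * z" "\<eta> * \<eta>' * L\<^sup>2 \<le> 4"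
  shows "0 \<le> z\<^sup>2 / \<eta>' - \<eta> * y\<^sup>2 / 4"
proof -
  have "\<eta> * \<eta>' * y\<^sup>2 \<le> \<eta> * \<eta>' * (L * z)\<^sup>2"
    using assms by (intro mult_left_mono power_mono) auto
  also have "\<dots> = (\<eta> * \<eta>' * L\<^sup>2) * z\<^sup>2"
    by (simp add: power_mult_distrib)
  also have "\<dots> \<le> 4 * z\<^sup>2"
    using assms by (intro mult_right_mono) auto
  finally show ?thesis
    using assms by (simp add: field_simps)
qed

lemma perturbed_energy_nonneg:
  fixes A :: "real ^ 'n ^ 'm"
  assumes "\<eta>1 > 0" "\<eta>2 > 0" "\<eta>1 * \<eta>2 * (onorm ((*v) A))\<^sup>2 \<le> 4"
  shows "0 \<le> perturbed_energy \<eta>1 \<eta>2 A u v"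
proof -
  have "0 \<le> (norm v)\<^sup>2 / \<eta>2 - \<eta>1 * (norm (A *v v))\<^sup>2 / 4"
    using assms norm_matrix_vector_le_onorm[of A v] by (intro square_defect_nonneg) auto
  then show ?thesis
    using assms by (simp add: perturbed_energy_eq_squares(1))
qed

text \<open>Square and remainder are both nonnegative, so the square vanishes in each of the two
  decompositions.\<close>

lemma perturbed_energy_zeroD:
  fixes A :: "real ^ 'n ^ 'm"
  assumes "\<eta>1 > 0" "\<eta>2 > 0" "\<eta>1 * \<eta>2 * (onorm ((*v) A))\<^sup>2 \<le> 4"
    and zero: "perturbed_energy \<eta>1 \<eta>2 A u v = 0"
  shows "\<eta>1 *\<^sub>R (A *v v) = - 2 *\<^sub>R u" "\<eta>2 *\<^sub>R (transpose A *v u) = - 2 *\<^sub>R v"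
proof -
  have eq: "x = 0" if "(norm x)\<^sup>2 / \<eta> + d = 0" "0 \<le> d" "\<eta> > 0"
    for x :: "'c::real_normed_vector" and \<eta> d :: real
  proof -
    have "(norm x)\<^sup>2 / \<eta> = 0"
      using that by (simp add: add_nonneg_eq_0_iff)
    then show ?thesis using that by simp
  qed
  have "0 \<le> (norm v)\<^sup>2 / \<eta>2 - \<eta>1 * (norm (A *v v))\<^sup>2 / 4"
    using assms norm_matrix_vector_le_onorm[of A v] by (intro square_defect_nonneg) auto
  then have "u + (\<eta>1 / 2) *\<^sub>R (A *v v) = 0"
    using eq zero assms(1,2) by (simp only: perturbed_energy_eq_squares(1))
  then have "2 *\<^sub>R (u + (\<eta>1 / 2) *\<^sub>R (A *v v)) = 0" by simp
  then show "\<eta>1 *\<^sub>R (A *v v) = - 2 *\<^sub>R u"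
    by (simp add: scaleR_add_right eq_neg_iff_add_eq_0 add.commute)
  have "0 \<le> (norm u)\<^sup>2 / \<eta>1 - \<eta>2 * (norm (transpose A *v u))\<^sup>2 / 4"
    using assms norm_transpose_le_onorm[of A u]
    by (intro square_defect_nonneg) (auto simp: mult.commute)
  then have "v + (\<eta>2 / 2) *\<^sub>R (transpose A *v u) = 0"
    using eq zero assms(1,2) by (simp only: perturbed_energy_eq_squares(2))
  then have "2 *\<^sub>R (v + (\<eta>2 / 2) *\<^sub>R (transpose A *v u)) = 0" by simp
  then show "\<eta>2 *\<^sub>R (transpose A *v u) = - 2 *\<^sub>R v"
    by (simp add: scaleR_add_right eq_neg_iff_add_eq_0 add.commute)
qed

theorem theorem9:
  fixes A :: "real ^ 'k2 ^ 'k1"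
    and \<eta>1 \<eta>2 :: real
    and x1 :: "nat \<Rightarrow> real ^ 'k1"
    and x2 :: "nat \<Rightarrow> real ^ 'k2"
  assumes "\<eta>1 > 0" and "\<eta>2 > 0"
    and "A \<noteq> 0 \<Longrightarrow> sqrt (\<eta>1 * \<eta>2) \<le> 2 / onorm ((*v) A)"
    and "(norm (x1 0))\<^sup>2 + (norm (x2 0))\<^sup>2 > 0"
    and "\<And>t. x1 (Suc t) = x1 t + \<eta>1 *\<^sub>R (A *v x2 t)"
    and "\<And>t. x2 (Suc t) = x2 t - \<eta>2 *\<^sub>R (transpose A *v x1 (Suc t))"
  shows "(\<exists>c>0. \<forall>t. (norm (x1 t))\<^sup>2 + (norm (x2 t))\<^sup>2 \<ge> c) \<and>
    (\<forall>t. (1 + sqrt (\<eta>1 * \<eta>2) * onorm ((*v) A) / 2) *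
            ((norm (x1 t))\<^sup>2 / \<eta>1 + (norm (x2 t))\<^sup>2 / \<eta>2)
        \<ge> (1 - sqrt (\<eta>1 * \<eta>2) * onorm ((*v) A) / 2) *
            ((norm (x1 0))\<^sup>2 / \<eta>1 + (norm (x2 0))\<^sup>2 / \<eta>2))"
proof -
  define s where "s = sqrt (\<eta>1 * \<eta>2) * onorm ((*v) A) / 2"
  define E where "E t = (norm (x1 t))\<^sup>2 / \<eta>1 + (norm (x2 t))\<^sup>2 / \<eta>2" for t
  define H where "H t = perturbed_energy \<eta>1 \<eta>2 A (x1 t) (x2 t)" for t
  have s0: "0 \<le> s"
    using assms(1,2) onorm_matrix_nonneg[of A] by (simp add: s_def)
  have s1: "s \<le> 1"
  \<comment> \<open>The step-size bound is assumed only for nonzero \<open>A\<close>, where division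
    by the norm is meaningful; for \<open>A = 0\<close> the norm is 0 and so is
    \<open>s\<close>.\<close>
  proof (cases "A = 0")
    case True
    then have "(*v) A = (\<lambda>_. 0)" by (simp add: fun_eq_iff)
    then show ?thesis by (simp add: s_def onorm_zero)
  next
    case False
    have "onorm ((*v) A) \<noteq> 0"
      using False by (auto simp: onorm_eq_0 matrix_vector_mul_bounded_linear matrix_eq)
    then have "onorm ((*v) A) > 0" using onorm_matrix_nonneg[of A] by simp
    with assms(3)[OF False] show ?thesis
      by (simp add: s_def field_simps)
  qed
  have "s\<^sup>2 \<le> 1" using s0 s1 by (simp add: power_le_one)
  then have small: "\<eta>1 * \<eta>2 * (onorm ((*v) A))\<^sup>2 \<le> 4"
    using assms(1,2) by (simp add: s_def power_mult_distrib power_divide)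
  have cons: "H t = H 0" for t
  proof (induction t)
    case (Suc t)
    then show ?case
      unfolding H_def using perturbed_energy_step[OF assms(1,2) assms(5,6)] by simp
  qed simp
  have cross: "\<bar>H t - E t\<bar> \<le> s * E t" for t
    using abs_cross_term_le[OF assms(1,2), of "x1 t" A "x2 t"]
    by (simp add: H_def E_def s_def perturbed_energy_def)
  have upper: "H t \<le> (1 + s) * E t" for t
    using cross[of t] by (simp add: abs_le_iff algebra_simps)
  have lower: "(1 - s) * E t \<le> H t" for t
    using cross[of t] by (simp add: abs_le_iff algebra_simps)
  have quantitative: "(1 + s) * E t \<ge> (1 - s) * E 0" for t
    using upper[of t] lower[of 0] cons[of t] by linarith
  have "\<exists>c>0. \<forall>t. (norm (x1 t))\<^sup>2 + (norm (x2 t))\<^sup>2 \<ge> c"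
  proof (cases "H 0 = 0")
    case True
    \<comment> \<open>By conservation the energy is zero at every time, so the zero equations are
      available at each step.\<close>
    have "norm (x1 (Suc t)) = norm (x1 t) \<and> norm (x2 (Suc t)) = norm (x2 t)" for t
    proof -
      have z: "perturbed_energy \<eta>1 \<eta>2 A (x1 t) (x2 t) = 0"
        using cons[of t] True by (simp add: H_def)
      have 1: "x1 (Suc t) = - x1 t"
        using perturbed_energy_zeroD(1)[OF assms(1,2) small z] assms(5)[of t]
        by (simp add: scaleR_2)
      \<comment> \<open>The second update sees the already negated \<open>x1\<close>, so it adds
        \<open>\<eta>2 *\<^sub>R (transpose A *v x1 t)\<close>, which is
        \<open>- 2 *\<^sub>R x2 t\<close>.\<close>
      have "transpose A *v (- x1 t) = - (transpose A *v x1 t)"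
        using matrix_vector_mult_scaleR[of "transpose A" "-1" "x1 t"] by simp
      then have "x2 (Suc t) = - x2 t"
        using perturbed_energy_zeroD(2)[OF assms(1,2) small z] assms(6)[of t]
        by (simp add: 1 scaleR_2)
      with 1 show ?thesis by simp
    qed
    then have "norm (x1 t) = norm (x1 0) \<and> norm (x2 t) = norm (x2 0)" for t
      by (induction t) auto
    then have "\<forall>t. (norm (x1 t))\<^sup>2 + (norm (x2 t))\<^sup>2 \<ge> (norm (x1 0))\<^sup>2 + (norm (x2 0))\<^sup>2"
      by (metis order_refl)
    then show ?thesis using assms(4) by blast
  next
    case False
    \<comment> \<open>The factor 2 bounds \<open>1 + s\<close>, and the sum dominates both weights
      \<open>1 / \<eta>1\<close> and \<open>1 / \<eta>2\<close> in \<open>E\<close>.\<close>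
    define K where "K = 2 * (1 / \<eta>1 + 1 / \<eta>2)"
    have H0: "H 0 > 0"
      using False perturbed_energy_nonneg[OF assms(1,2) small, of "x1 0" "x2 0"]
      by (simp add: H_def)
    have K: "K > 0" using assms(1,2) by (simp add: K_def add_pos_pos)
    have "H 0 / K \<le> (norm (x1 t))\<^sup>2 + (norm (x2 t))\<^sup>2" for t
    proof -
      have E0: "0 \<le> E t" using assms(1,2) by (simp add: E_def)
      have "H 0 \<le> (1 + s) * E t" using upper[of t] cons[of t] by simp
      also have "\<dots> \<le> 2 * E t" using s1 E0 by (intro mult_right_mono) auto
      also have "\<dots> \<le> K * ((norm (x1 t))\<^sup>2 + (norm (x2 t))\<^sup>2)"
      proof -
        \<comment> \<open>These mismatched terms are exactly the excess of the right-hand side over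
          \<open>2 * E t\<close>.\<close>
        have "0 \<le> 2 * ((norm (x1 t))\<^sup>2 / \<eta>2 + (norm (x2 t))\<^sup>2 / \<eta>1)"
          using assms(1,2) by simp
        then show ?thesis by (simp add: K_def E_def algebra_simps)
      qed
      finally show ?thesis using K by (simp add: field_simps)
    qed
    then show ?thesis using H0 K by (intro exI[of _ "H 0 / K"]) simp
  qed
  with quantitative show ?thesis
    by (simp add: s_def E_def)
qed

end
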